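(* Let $G$ be the infinite planar graph of the chair tiling in which every tile is given 8 vertices. Then $G$ is bipartite and thus 2-colourable; its chromatic number is $\chi(G)=2$.
   Context: Chair substitution. The prototile is the L-shaped polygon $C=\overline{[0,2]^2\setminus[1,2]^2}$ (a union of three unit squares). The substitution $\omega$ replaces $C$ by the dissection of $2C=\overline{[0,4]^2\setminus[2,4]^2}$ into four tiles congruent to $C$: the tile $C$; the tile $C+(1,1)$; the tile $\overline{[0,2]\times[2,4]\setminus[1,2]\times[2,3]}$; and the tile $\overline{[2,4]\times[0,2]\setminus[2,3]\times[1,2]}$. It is extended to translates and rotations (by multiples of $90^\circ$) of $C$, and to collections of such tiles, in the obvious covariant way (expand by the factor 2, then dissect each expanded tile). The chair tiling is the fixed point tiling of the plane produced by this substitution. Graph with 8 vertices per tile: the 8 vertices of the tile $C$ are $(0,0),(1,0),(2,0),(2,1),(1,1),(1,2),(0,2),(0,1)$, and correspondingly for every translated or rotated tile. The edges are the unit segments of the tile boundaries joining consecutive vertices, and the faces are the tiles. *)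

theory Defs
  imports "HOL-Analysis.Analysis" "HOL-Library.Extended_Nat"
begin

section \<open>The chair substitution\<close>

text \<open>The plane is \<^typ>\<open>complex\<close>, so that rotation by 90 degrees is multiplication by \<^term>\<open>\<i>\<close>.\<close>

definition chair :: "complex set" where
  "chair = closure (cbox 0 (Complex 2 2) - cbox (Complex 1 1) (Complex 2 2))"

definition placed :: "nat \<Rightarrow> complex \<Rightarrow> complex \<Rightarrow> complex" where
  "placed k t z = \<i> ^ k * z + t"

definition tile :: "nat \<Rightarrow> complex \<Rightarrow> complex set" where
  "tile k t = placed k t ` chair"

definition chair_dissection :: "complex set set" where
  "chair_dissection =
    {chair,
     (+) (Complex 1 1) ` chair,
     closure (cbox (Complex 0 2) (Complex 2 4) - cbox (Complex 1 2) (Complex 2 3)),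
     closure (cbox (Complex 2 0) (Complex 4 2) - cbox (Complex 2 1) (Complex 3 2))}"

text \<open>Doubling \<^term>\<open>tile k t\<close> gives the image of the doubled chair under \<^term>\<open>placed k (2 * t)\<close>.\<close>

definition chair_subst :: "complex set set \<Rightarrow> complex set set" where
  "chair_subst T = {placed k (2 * t) ` D | k t D. tile k t \<in> T \<and> D \<in> chair_dissection}"

definition plane_tiling :: "complex set set \<Rightarrow> bool" where
  "plane_tiling T \<longleftrightarrow>
     (\<forall>\<tau>\<in>T. \<exists>k t. \<tau> = tile k t) \<and>
     \<Union>T = UNIV \<and>
     (\<forall>\<sigma>\<in>T. \<forall>\<tau>\<in>T. \<sigma> \<noteq> \<tau> \<longrightarrow> interior \<sigma> \<inter> interior \<tau> = {})"

text \<open>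
  The substitution has several fixed points among the tilings of the plane (four chairs with their
  outer corners at the origin generate one, a chair and a second one filling its notch
  generate another), so this is a predicate on tilings. It is satisfiable, see
  \<open>chair_tiling_exists\<close> below.
\<close>

definition chair_tiling :: "complex set set \<Rightarrow> bool" where
  "chair_tiling T \<longleftrightarrow> plane_tiling T \<and> chair_subst T = T"


section \<open>The graph with 8 vertices per tile\<close>

definition chair_corners :: "complex list" where
  "chair_corners = [Complex 0 0, Complex 1 0, Complex 2 0, Complex 2 1,
                    Complex 1 1, Complex 1 2, Complex 0 2, Complex 0 1]"

definition tiling_vertices :: "complex set set \<Rightarrow> complex set" where
  "tiling_vertices T = {placed k t v | k t v. tile k t \<in> T \<and> v \<in> set chair_corners}"

text \<open>An edge is represented by the set of the two end points of the unit segment.\<close>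

definition tiling_edges :: "complex set set \<Rightarrow> complex set set" where
  "tiling_edges T =
    {{placed k t (chair_corners ! j), placed k t (chair_corners ! ((j + 1) mod 8))} | k t j.
       tile k t \<in> T \<and> j < 8}"


section \<open>Bipartite graphs and colourings\<close>

definition bipartite :: "'a set \<Rightarrow> 'a set set \<Rightarrow> bool" where
  "bipartite V E \<longleftrightarrow>
     (\<exists>A B. A \<union> B = V \<and> A \<inter> B = {} \<and> (\<forall>e\<in>E. \<exists>a\<in>A. \<exists>b\<in>B. e = {a, b}))"

definition colourable :: "'a set \<Rightarrow> 'a set set \<Rightarrow> nat \<Rightarrow> bool" where
  "colourable V E n \<longleftrightarrow>
     (\<exists>c :: 'a \<Rightarrow> nat. (\<forall>v\<in>V. c v < n) \<and> (\<forall>u v. {u, v} \<in> E \<longrightarrow> c u \<noteq> c v))"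

definition chromatic_number :: "'a set \<Rightarrow> 'a set set \<Rightarrow> enat" where
  "chromatic_number V E = (INF n \<in> {n. colourable V E n}. enat n)"


section \<open>The substitution is well defined and has a fixed point tiling\<close>

lemma closure_box_diff:
  fixes a b c d p q p' q' :: complex
  assumes "box p q \<subseteq> cbox a b - cbox c d" "box p' q' \<subseteq> cbox a b - cbox c d"
    "box p q \<noteq> {}" "box p' q' \<noteq> {}" "cbox a b - cbox c d \<subseteq> cbox p q \<union> cbox p' q'"
  shows "closure (cbox a b - cbox c d) = cbox p q \<union> cbox p' q'"
proof
  show "closure (cbox a b - cbox c d) \<subseteq> cbox p q \<union> cbox p' q'"
    by (rule closure_minimal) (use assms(5) in auto)
  have "cbox p q = closure (box p q)" "cbox p' q' = closure (box p' q')"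
    using assms(3,4) by (simp_all add: closure_box)
  then show "cbox p q \<union> cbox p' q' \<subseteq> closure (cbox a b - cbox c d)"
    using closure_mono[OF assms(1)] closure_mono[OF assms(2)] by auto
qed

lemma box_complex_nonempty: "Re a < Re b \<Longrightarrow> Im a < Im b \<Longrightarrow> box a b \<noteq> {}"
  by (auto simp: box_ne_empty Basis_complex_def)

lemma chair_eq: "chair = cbox 0 (Complex 1 2) \<union> cbox 0 (Complex 2 1)"
  unfolding chair_def
  by (rule closure_box_diff)
    (auto simp: in_cbox_complex_iff in_box_complex_iff box_complex_nonempty)

lemma upper_eq:
  "closure (cbox (Complex 0 2) (Complex 2 4) - cbox (Complex 1 2) (Complex 2 3)) =
   cbox (Complex 0 2) (Complex 1 4) \<union> cbox (Complex 0 3) (Complex 2 4)"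
  by (rule closure_box_diff)
    (auto simp: in_cbox_complex_iff in_box_complex_iff box_complex_nonempty)

lemma right_eq:
  "closure (cbox (Complex 2 0) (Complex 4 2) - cbox (Complex 2 1) (Complex 3 2)) =
   cbox (Complex 2 0) (Complex 4 1) \<union> cbox (Complex 3 0) (Complex 4 2)"
  by (rule closure_box_diff)
    (auto simp: in_cbox_complex_iff in_box_complex_iff box_complex_nonempty)

lemma i_power_cancel: "\<i> ^ k * (\<i> ^ (3 * k) * z) = z"
proof -
  have "\<i> ^ k * \<i> ^ (3 * k) = (\<i> ^ 4) ^ k"
    by (simp flip: power_add power_mult)
  then show ?thesis by (simp add: mult.assoc[symmetric])
qed

lemma placed_inverse: "placed k t (\<i> ^ (3 * k) * (z - t)) = z"
  by (simp add: placed_def i_power_cancel)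

lemma placed_iff: "z \<in> placed k t ` S \<longleftrightarrow> \<i> ^ (3 * k) * (z - t) \<in> S"
proof
  assume "z \<in> placed k t ` S"
  then obtain s where "s \<in> S" "z = \<i> ^ k * s + t" by (auto simp: placed_def)
  then show "\<i> ^ (3 * k) * (z - t) \<in> S"
    by (metis add_diff_cancel_right' i_power_cancel mult.left_commute)
next
  assume "\<i> ^ (3 * k) * (z - t) \<in> S"
  then show "z \<in> placed k t ` S" by (metis image_eqI placed_inverse)
qed

lemma mem_chair: "z \<in> chair \<longleftrightarrow> 0 \<le> Re z \<and> Re z \<le> 2 \<and> 0 \<le> Im z \<and> Im z \<le> 2 \<and> (Re z \<le> 1 \<or> Im z \<le> 1)"
  by (auto simp: chair_eq in_cbox_complex_iff)

lemma i_power_mod4: "\<i> ^ k = \<i> ^ (k mod 4)"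
proof -
  have "\<i> ^ k = \<i> ^ (4 * (k div 4) + k mod 4)" by simp
  also have "\<dots> = \<i> ^ (k mod 4)" by (simp only: power_add power_mult) simp
  finally show ?thesis .
qed

lemma tile_mod4: "tile k t = tile (k mod 4) t"
  unfolding tile_def placed_def using i_power_mod4[of k] by simp

lemma mod4_cases: "(k::nat) mod 4 = 0 \<or> k mod 4 = 1 \<or> k mod 4 = 2 \<or> k mod 4 = 3"
  by presburger

lemma tile_eq_chair:
  assumes "tile m s = chair" shows "m mod 4 = 0 \<and> s = 0"
proof -
  have *: "placed (m mod 4) s z \<in> chair" if "z \<in> chair" for z
    using assms that tile_mod4[of m s] by (auto simp: tile_def)
  have c: "0 \<in> chair" "2 \<in> chair" "2 * \<i> \<in> chair" by (auto simp: mem_chair)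
  have "0 \<in> tile m s" using assms c by simp
  then obtain z where z: "z \<in> chair" "0 = placed (m mod 4) s z"
    unfolding tile_mod4[of m s] by (auto simp: tile_def)
  have i3: "\<i> ^ 3 = - \<i>" by (simp add: power3_eq_cube)
  define r where "r = m mod 4"
  have chairs: "placed r s 0 \<in> chair" "placed r s 2 \<in> chair" "placed r s (2 * \<i>) \<in> chair"
    using *[OF c(1)] *[OF c(2)] *[OF c(3)] by (simp_all add: r_def)
  have z0: "Re (placed r s z) = 0" "Im (placed r s z) = 0"
    using z(2) unfolding r_def by (metis zero_complex.sel)+
  consider "r = 0" | "r = 1" | "r = 2" | "r = 3"
    using mod4_cases[of m] unfolding r_def by linarith
  then have "r = 0 \<and> Re s = 0 \<and> Im s = 0"
  proof cases
    case 1
    then show ?thesis using chairs z0 z(1) by (simp add: mem_chair placed_def)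
  next
    case 2
    then show ?thesis using chairs z0 z(1) by (simp add: mem_chair placed_def)
  next
    case 3
    then show ?thesis using chairs z0 z(1) by (simp add: mem_chair placed_def)
  next
    case 4
    then show ?thesis using chairs z0 z(1) by (simp add: mem_chair placed_def i3)
  qed
  then show ?thesis by (simp add: r_def complex_eq_iff)
qed

lemma placed_placed: "placed k t ` placed m s ` S = placed (k + m) (\<i> ^ k * s + t) ` S"
  by (auto simp: image_image placed_def algebra_simps power_add)

lemma placed_cong: "\<i> ^ k = \<i> ^ k' \<Longrightarrow> placed k t = placed k' t"
  by (simp add: placed_def fun_eq_iff)

text \<open>A tile determines its rotation and translation, so \<^const>\<open>chair_subst\<close> dissects each tile in only one way.\<close>

lemma tile_inject:
  assumes "tile k t = tile k' t'" shows "\<i> ^ k = \<i> ^ k' \<and> t = t'"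
proof -
  let ?b = "3 * k" let ?u = "- (\<i> ^ ?b * t)"
  have "placed ?b ?u ` tile k t = placed ?b ?u ` tile k' t'" using assms by simp
  moreover have "placed ?b ?u ` tile k t = chair"
  proof -
    have "placed ?b ?u (placed k t z) = z" for z
      using i_power_cancel[of k z] by (simp add: placed_def distrib_left mult.left_commute)
    then show ?thesis by (simp add: tile_def image_image)
  qed
  ultimately have "tile (?b + k') (\<i> ^ ?b * t' + ?u) = chair"
    by (simp add: tile_def placed_placed)
  then have m: "(?b + k') mod 4 = 0" and "\<i> ^ ?b * t' + ?u = 0"
    using tile_eq_chair by blast+
  then have "t = t'" by simp
  moreover have "k mod 4 = k' mod 4" using m by presburger
  then have "\<i> ^ k = \<i> ^ k'" using i_power_mod4 by metis
  ultimately show ?thesis by simp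
qed

lemma dissection_tile:
  assumes "D \<in> chair_dissection" obtains m s where "D = tile m s"
proof -
  have "chair = tile 0 0" by (simp add: tile_def placed_def)
  moreover have "(+) (Complex 1 1) ` chair = tile 0 (Complex 1 1)"
    by (auto simp: tile_def placed_def add.commute)
  moreover have "cbox (Complex 0 2) (Complex 1 4) \<union> cbox (Complex 0 3) (Complex 2 4) = tile 3 (Complex 0 4)"
    unfolding tile_def set_eq_iff placed_iff i_power_mod4[of "3 * 3"] mem_chair
    by (auto simp: in_cbox_complex_iff)
  moreover have "cbox (Complex 2 0) (Complex 4 1) \<union> cbox (Complex 3 0) (Complex 4 2) = tile 1 (Complex 4 0)"
    unfolding tile_def set_eq_iff placed_iff mem_chair
    by (auto simp: in_cbox_complex_iff numeral_3_eq_3)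
  ultimately show thesis
    using assms that unfolding chair_dissection_def upper_eq right_eq by auto
qed

lemma dissection_Union: "\<Union>chair_dissection = (\<lambda>z. 2 * z) ` chair"
proof -
  have "z \<in> (\<lambda>z. 2 * z) ` chair \<longleftrightarrow> z / 2 \<in> chair" for z :: complex
    by (auto intro!: image_eqI[of _ _ "z / 2"])
  moreover have "z \<in> (+) (Complex 1 1) ` chair \<longleftrightarrow> z - Complex 1 1 \<in> chair" for z
    by (auto intro!: image_eqI[of _ _ "z - Complex 1 1"])
  ultimately show ?thesis
    unfolding chair_dissection_def upper_eq right_eq set_eq_iff
    by (auto simp: mem_chair in_cbox_complex_iff)
qed

definition grid :: "complex set" where
  "grid = {z. Re z \<in> \<int> \<or> Im z \<in> \<int>}"

lemma interior_grid: "interior grid = {}"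
proof -
  have "grid = (\<Union>n::int. {z. z \<bullet> 1 = of_int n} \<union> {z. z \<bullet> \<i> = of_int n})"
    by (auto simp: grid_def Ints_def inner_complex_def)
  moreover have "negligible {z::complex. z \<bullet> 1 = of_int n}"
    "negligible {z::complex. z \<bullet> \<i> = of_int n}" for n
    by (rule negligible_standard_hyperplane; simp add: Basis_complex_def)+
  then have "negligible ({z::complex. z \<bullet> 1 = of_int n} \<union> {z. z \<bullet> \<i> = of_int n})" for n
    by (rule negligible_Un)
  then have "negligible (\<Union>n::int. {z::complex. z \<bullet> 1 = of_int n} \<union> {z. z \<bullet> \<i> = of_int n})"
    by (intro negligible_countable_Union) auto
  ultimately have "negligible grid" by simp
  then show ?thesis
    by (meson interior_subset negligible_subset open_interior open_not_negligible)
qed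

lemma interior_disjoint_grid:
  assumes "A \<inter> B \<subseteq> grid" shows "interior A \<inter> interior B = {}"
  using interior_mono[OF assms] interior_grid by (simp add: interior_Int)

lemma dissection_disjoint:
  assumes "A \<in> chair_dissection" "B \<in> chair_dissection" "A \<noteq> B"
  shows "interior A \<inter> interior B = {}"
proof (rule interior_disjoint_grid, rule subsetI, rule ccontr)
  fix z assume z: "z \<in> A \<inter> B" and "z \<notin> grid"
  then have ne: "Re z \<noteq> of_int n" "Im z \<noteq> of_int n" for n by (auto simp: grid_def)
  have chair': "z \<in> (+) (Complex 1 1) ` chair \<longleftrightarrow>
      1 \<le> Re z \<and> Re z \<le> 3 \<and> 1 \<le> Im z \<and> Im z \<le> 3 \<and> (Re z \<le> 2 \<or> Im z \<le> 2)"
  proof -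
    have "z \<in> (+) (Complex 1 1) ` chair \<longleftrightarrow> z - Complex 1 1 \<in> chair"
      by (auto intro!: image_eqI[of _ _ "z - Complex 1 1"])
    then show ?thesis by (auto simp: mem_chair)
  qed
  have up: "z \<in> cbox (Complex 0 2) (Complex 1 4) \<union> cbox (Complex 0 3) (Complex 2 4) \<longleftrightarrow>
      0 \<le> Re z \<and> Re z \<le> 2 \<and> 2 \<le> Im z \<and> (Re z \<le> 1 \<or> 3 \<le> Im z) \<and> Im z \<le> 4"
    by (auto simp: in_cbox_complex_iff)
  have ri: "z \<in> cbox (Complex 2 0) (Complex 4 1) \<union> cbox (Complex 3 0) (Complex 4 2) \<longleftrightarrow>
      0 \<le> Im z \<and> Im z \<le> 2 \<and> 2 \<le> Re z \<and> (Im z \<le> 1 \<or> 3 \<le> Re z) \<and> Re z \<le> 4"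
    by (auto simp: in_cbox_complex_iff)
  have ne': "Re z \<noteq> 1" "Re z \<noteq> 2" "Re z \<noteq> 3" "Im z \<noteq> 1" "Im z \<noteq> 2" "Im z \<noteq> 3"
    using ne[of 1] ne[of 2] ne[of 3] by simp_all
  show False
    using assms z unfolding chair_dissection_def upper_eq right_eq
    by (elim insertE emptyE IntE; simp only: mem_chair chair' up ri; use ne' in linarith)
qed

lemma interior_placed: "interior (placed k t ` S) = placed k t ` interior S"
proof -
  have eq: "placed k t ` X = (+) t ` (\<lambda>z. \<i> ^ k * z) ` X" for X
    by (auto simp: image_image placed_def add.commute)
  have "linear (\<lambda>z. \<i> ^ k * z)" by (rule bounded_linear.linear) (rule bounded_linear_mult_right)
  moreover have "inj (\<lambda>z. \<i> ^ k * z)" by (auto intro: injI)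
  ultimately show ?thesis
    unfolding eq interior_translation by (simp add: interior_injective_linear_image)
qed

lemma interior_double: "interior ((\<lambda>z. 2 * z) ` S) = (\<lambda>z::complex. 2 * z) ` interior S"
proof -
  have "linear (\<lambda>z::complex. 2 * z)" by (rule bounded_linear.linear) (rule bounded_linear_mult_right)
  moreover have "inj (\<lambda>z::complex. 2 * z)" by (auto intro: injI)
  ultimately show ?thesis by (simp add: interior_injective_linear_image)
qed

lemma inj_placed: "inj (placed k t)"
  by (auto intro: injI simp: placed_def)

lemma placed_double: "placed k (2 * t) ` (\<lambda>z. 2 * z) ` S = (\<lambda>z. 2 * z) ` placed k t ` S"
  by (auto simp: image_image placed_def algebra_simps)

lemma subst_disjoint:
  assumes T: "\<And>\<sigma> \<tau>. \<sigma> \<in> T \<Longrightarrow> \<tau> \<in> T \<Longrightarrow> \<sigma> \<noteq> \<tau> \<Longrightarrow> interior \<sigma> \<inter> interior \<tau> = {}"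
    and "\<sigma> \<in> chair_subst T" "\<tau> \<in> chair_subst T" "\<sigma> \<noteq> \<tau>"
  shows "interior \<sigma> \<inter> interior \<tau> = {}"
proof -
  obtain k t D where 1: "\<sigma> = placed k (2 * t) ` D" "tile k t \<in> T" "D \<in> chair_dissection"
    using assms unfolding chair_subst_def by auto
  obtain k' t' D' where 2: "\<tau> = placed k' (2 * t') ` D'" "tile k' t' \<in> T" "D' \<in> chair_dissection"
    using assms unfolding chair_subst_def by auto
  show ?thesis
  proof (cases "tile k t = tile k' t'")
    case True
    then have "placed k' (2 * t') = placed k (2 * t)"
      using tile_inject[of k t k' t'] placed_cong by metis
    then have "\<tau> = placed k (2 * t) ` D'" using 2 by simp
    moreover have "D \<noteq> D'" using calculation 1 assms(4) by auto
    then have "interior D \<inter> interior D' = {}" using dissection_disjoint 1 2 by blast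
    ultimately show ?thesis
      using 1 by (simp add: interior_placed flip: image_Int[OF inj_placed])
  next
    case False
    have "\<sigma> \<subseteq> (\<lambda>z. 2 * z) ` tile k t" "\<tau> \<subseteq> (\<lambda>z. 2 * z) ` tile k' t'"
      using 1 2 dissection_Union unfolding tile_def placed_double[symmetric] by blast+
    then have "interior \<sigma> \<subseteq> (\<lambda>z. 2 * z) ` interior (tile k t)"
      "interior \<tau> \<subseteq> (\<lambda>z. 2 * z) ` interior (tile k' t')"
      using interior_mono interior_double by metis+
    moreover have "interior (tile k t) \<inter> interior (tile k' t') = {}"
      using T 1 2 False by blast
    ultimately show ?thesis by fastforce
  qed
qed

lemma subst_tile:
  assumes "\<tau> \<in> chair_subst T" shows "\<exists>k t. \<tau> = tile k t"
proof -
  obtain k t D where 1: "\<tau> = placed k (2 * t) ` D" "D \<in> chair_dissection"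
    using assms unfolding chair_subst_def by auto
  obtain m s where "D = tile m s" using dissection_tile 1 by blast
  then show ?thesis using 1 by (auto simp: tile_def placed_placed)
qed

lemma subst_Union:
  assumes "\<forall>\<tau>\<in>T. \<exists>k t. \<tau> = tile k t"
  shows "\<Union>(chair_subst T) = (\<lambda>z. 2 * z) ` \<Union>T"
proof -
  have "\<Union>(chair_subst T) = (\<Union>(k, t)\<in>{(k, t). tile k t \<in> T}. placed k (2 * t) ` \<Union>chair_dissection)"
    unfolding chair_subst_def by (auto; blast)
  also have "\<dots> = (\<Union>(k, t)\<in>{(k, t). tile k t \<in> T}. (\<lambda>z. 2 * z) ` tile k t)"
    by (simp add: dissection_Union placed_double tile_def)
  also have "\<dots> = (\<lambda>z. 2 * z) ` (\<Union>(k, t)\<in>{(k, t). tile k t \<in> T}. tile k t)"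
    by (simp add: image_UN case_prod_unfold)
  also have "(\<Union>(k, t)\<in>{(k, t). tile k t \<in> T}. tile k t) = \<Union>T"
  proof (intro equalityI subsetI)
    fix z assume "z \<in> \<Union>T"
    then obtain \<tau> where \<tau>: "\<tau> \<in> T" "z \<in> \<tau>" by blast
    then obtain k t where "\<tau> = tile k t" using assms by blast
    then show "z \<in> (\<Union>(k, t)\<in>{(k, t). tile k t \<in> T}. tile k t)" using \<tau> by blast
  qed blast
  finally show ?thesis .
qed

lemma subst_mono: "S \<subseteq> T \<Longrightarrow> chair_subst S \<subseteq> chair_subst T"
  unfolding chair_subst_def by blast

lemma chair_tiling_exists: "\<exists>T. chair_tiling T"
proof -
  define S where "S = (\<lambda>k. tile k 0) ` {..<4}"
  define P where "P = (\<lambda>n. (chair_subst ^^ n) S)"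
  have P0: "P 0 = S" and PS: "P (Suc n) = chair_subst (P n)" for n
    by (simp_all add: P_def)
  have "S \<subseteq> chair_subst S"
  proof
    fix \<tau> assume "\<tau> \<in> S"
    then obtain k where k: "\<tau> = tile k 0" "tile k 0 \<in> S" by (auto simp: S_def)
    have "chair \<in> chair_dissection" by (simp add: chair_dissection_def)
    moreover have "\<tau> = placed k (2 * 0) ` chair" using k by (simp add: tile_def)
    ultimately show "\<tau> \<in> chair_subst S" unfolding chair_subst_def using k by blast
  qed
  then have "P n \<subseteq> P (Suc n)" for n
    by (induction n) (auto simp: P0 PS dest: subst_mono)
  then have mono: "m \<le> n \<Longrightarrow> P m \<subseteq> P n" for m n by (rule lift_Suc_mono_le)
  define T where "T = (\<Union>n. P n)"
  have "chair_subst T = (\<Union>n. P (Suc n))"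
    unfolding T_def PS by (auto simp: chair_subst_def)
  also have "\<dots> = T" unfolding T_def using mono[of _ "Suc _"] by (auto; meson le_SucI order_refl subsetD)
  finally have fixed: "chair_subst T = T" .
  have tiles: "\<forall>\<tau>\<in>P n. \<exists>k t. \<tau> = tile k t" for n
    using subst_tile by (cases n) (auto simp: P0 PS S_def)
  have i_pows: "\<i> ^ (3 * 0) = 1" "\<i> ^ (3 * 1) = - \<i>" "\<i> ^ (3 * 2) = - 1" "\<i> ^ (3 * 3) = \<i>"
    unfolding power_mult by (simp_all add: power3_eq_cube power2_eq_square)
  have S_mem: "z \<in> \<Union>S \<longleftrightarrow> z \<in> chair \<or> - \<i> * z \<in> chair \<or> - z \<in> chair \<or> \<i> * z \<in> chair" for z
  proof -
    have "z \<in> \<Union>S \<longleftrightarrow> (\<exists>k<4. \<i> ^ (3 * k) * z \<in> chair)"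
      by (auto simp: S_def tile_def placed_iff)
    also have "\<dots> \<longleftrightarrow> (\<exists>k\<in>{0,1,2,3::nat}. \<i> ^ (3 * k) * z \<in> chair)"
      by (auto simp: numeral_eq_Suc less_Suc_eq)
    finally have eq: "z \<in> \<Union>S \<longleftrightarrow> (\<exists>k\<in>{0,1,2,3::nat}. \<i> ^ (3 * k) * z \<in> chair)" .
    show ?thesis unfolding eq by (simp only: i_pows bex_simps) simp
  qed
  have ball: "z \<in> \<Union>S" if "\<bar>Re z\<bar> \<le> 1" "\<bar>Im z\<bar> \<le> 1" for z
    using that unfolding S_mem mem_chair by (auto simp: abs_le_iff)
  have cover: "z \<in> \<Union>(P n)" if "\<bar>Re z\<bar> \<le> 2 ^ n" "\<bar>Im z\<bar> \<le> 2 ^ n" for z n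
    using that
  proof (induction n arbitrary: z)
    case 0 then show ?case using ball by (simp add: P0)
  next
    case (Suc n)
    then have "z / 2 \<in> \<Union>(P n)" by (intro Suc.IH) (auto simp: abs_le_iff)
    then have "2 * (z / 2) \<in> \<Union>(P (Suc n))" unfolding PS subst_Union[OF tiles] by blast
    then show ?case by simp
  qed
  have "z \<in> \<Union>T" for z
  proof -
    obtain n where "norm z < 2 ^ n" using real_arch_pow[of 2 "norm z"] by auto
    then have "z \<in> \<Union>(P n)"
      using abs_Re_le_cmod[of z] abs_Im_le_cmod[of z] by (intro cover) auto
    then show ?thesis by (auto simp: T_def)
  qed
  then have cov: "\<Union>T = UNIV" by blast
  have "interior \<sigma> \<inter> interior \<tau> = {}" if "\<sigma> \<in> P n" "\<tau> \<in> P n" "\<sigma> \<noteq> \<tau>" for n \<sigma> \<tau>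
    using that
  proof (induction n arbitrary: \<sigma> \<tau>)
    case 0
    then obtain j k where jk: "\<sigma> = tile j 0" "\<tau> = tile k 0" "j < 4" "k < 4" "j \<noteq> k"
      by (auto simp: P0 S_def)
    show ?case
    proof (rule interior_disjoint_grid, rule subsetI)
      fix z assume "z \<in> \<sigma> \<inter> \<tau>"
      then have "\<i> ^ (3 * j) * z \<in> chair" "\<i> ^ (3 * k) * z \<in> chair"
        using jk by (auto simp: tile_def placed_iff)
      moreover have "j \<in> {0,1,2,3}" "k \<in> {0,1,2,3}" using jk by auto
      ultimately have "j \<in> {0,1,2,3}" "k \<in> {0,1,2,3}"
        "\<i> ^ (3 * j) * z \<in> chair" "\<i> ^ (3 * k) * z \<in> chair" by blast+
      then have "Re z = 0 \<or> Im z = 0"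
        using jk(5)
        by (elim insertE emptyE; simp only: i_pows mem_chair; simp)
      then show "z \<in> grid" by (auto simp: grid_def)
    qed
  next
    case (Suc n)
    show ?case by (rule subst_disjoint[of "P n"]) (use Suc in \<open>auto simp: PS\<close>)
  qed
  then have "interior \<sigma> \<inter> interior \<tau> = {}" if "\<sigma> \<in> T" "\<tau> \<in> T" "\<sigma> \<noteq> \<tau>" for \<sigma> \<tau>
    using that mono unfolding T_def by (auto; meson disjoint_iff le_cases subsetD)
  then have "chair_tiling T"
    unfolding chair_tiling_def plane_tiling_def using fixed cov tiles by (auto simp: T_def)
  then show ?thesis by blast
qed

end

theory Submission
  imports Defs
begin

text \<open>
  Colour a vertex by the parity of the sum of its coordinates; the point is that all tiles lie at
  Gaussian integer positions, although a tiling fixed by the substitution is not assumed to be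
  aligned with the integer grid. Near the origin a tile \<open>\<tau>\<close> containing \<open>0\<close> agrees with its double, so
  a tile of the dissected double of \<open>\<tau>\<close> that contains \<open>0\<close> overlaps \<open>\<tau>\<close>, hence equals \<open>\<tau>\<close>; this gives
  an equation \<open>t = i^k s + 2 t\<close> with \<open>s\<close> a Gaussian integer for the position \<open>t\<close> of \<open>\<tau>\<close>.
  An arbitrary tile has an infinite chain of ancestors, all meeting a fixed bounded set. As the
  interiors are disjoint, two of them coincide, and an ancestor \<open>\<sigma>\<close> contained in \<open>2^p \<sigma>\<close>
  contains \<open>0\<close> because it is closed. Integrality then descends from this ancestor.
\<close>

section \<open>Gaussian integers and the parity colouring\<close>

definition gaussian_ints :: "complex set" where
  "gaussian_ints = {z. Re z \<in> \<int> \<and> Im z \<in> \<int>}"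

lemma gaussian_ints_add: "z \<in> gaussian_ints \<Longrightarrow> w \<in> gaussian_ints \<Longrightarrow> z + w \<in> gaussian_ints"
  by (simp add: gaussian_ints_def)

lemma gaussian_ints_uminus: "z \<in> gaussian_ints \<Longrightarrow> - z \<in> gaussian_ints"
  by (simp add: gaussian_ints_def)

lemma gaussian_ints_double: "z \<in> gaussian_ints \<Longrightarrow> 2 * z \<in> gaussian_ints"
  by (simp add: gaussian_ints_def)

lemma gaussian_ints_i_power: "z \<in> gaussian_ints \<Longrightarrow> \<i> ^ k * z \<in> gaussian_ints"
proof (induction k)
  case (Suc k)
  have "\<i> * w \<in> gaussian_ints" if "w \<in> gaussian_ints" for w
    using that by (simp add: gaussian_ints_def)
  from this[OF Suc.IH[OF Suc.prems]] show ?case by (simp add: mult.assoc)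
qed simp

text \<open>The floors only make the parity total. At Gaussian integers it means divisibility by
  \<open>1 + \<i>\<close>.\<close>

definition even_point :: "complex \<Rightarrow> bool" where
  "even_point z \<longleftrightarrow> even (\<lfloor>Re z\<rfloor> + \<lfloor>Im z\<rfloor>)"

text \<open>The floor commutes with adding an integer, so \<open>w\<close> may be arbitrary.\<close>

lemma even_point_add:
  assumes "z \<in> gaussian_ints"
  shows "even_point (z + w) \<longleftrightarrow> (even_point z \<longleftrightarrow> even_point w)"
  using assms by (auto simp: gaussian_ints_def even_point_def elim!: Ints_cases)

text \<open>Multiplication by \<open>\<i>\<close> sends \<open>(x, y)\<close> to
  \<open>(-y, x)\<close>, and an integer has the parity of its negative.\<close>

lemma even_point_i_power:
  assumes "z \<in> gaussian_ints"
  shows "even_point (\<i> ^ k * z) \<longleftrightarrow> even_point z"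
proof (induction k)
  case (Suc k)
  have "even_point (\<i> * w) \<longleftrightarrow> even_point w" if "w \<in> gaussian_ints" for w
    using that by (auto simp: gaussian_ints_def even_point_def elim!: Ints_cases)
  from this[OF gaussian_ints_i_power[OF assms]] Suc show ?case by (simp add: mult.assoc)
qed simp

lemma chair_corners_gaussian_ints: "set chair_corners \<subseteq> gaussian_ints"
  by (simp add: chair_corners_def gaussian_ints_def)

lemma nth_chair_corners_gaussian_ints: "j < 8 \<Longrightarrow> chair_corners ! j \<in> gaussian_ints"
  using chair_corners_gaussian_ints nth_mem[of j chair_corners] by (auto simp: chair_corners_def)

lemma even_point_chair_corners:
  assumes "j < 8" shows "even_point (chair_corners ! j) \<longleftrightarrow> even j"
proof -
  have "j \<in> {0,1,2,3,4,5,6,7}" using assms by auto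
  then show ?thesis by (auto simp: chair_corners_def even_point_def)
qed

text \<open>Rotation keeps the parity, and translation by \<open>t\<close> flips it at all corners
  of a tile or at none. So the alternation along the boundary of the chair carries over to every
  tile at a Gaussian integer.\<close>

lemma even_point_placed:
  assumes "v \<in> gaussian_ints" "t \<in> gaussian_ints"
  shows "even_point (placed k t v) \<longleftrightarrow> (even_point t \<longleftrightarrow> even_point v)"
  using assms
  by (auto simp: placed_def even_point_add gaussian_ints_i_power even_point_i_power)

text \<open>Sharpens \<open>dissection_tile\<close> by reading off the positions \<open>0\<close>,
  \<open>1 + \<i>\<close>, \<open>4 * \<i>\<close> and \<open>4\<close> of the four pieces.\<close>

lemma dissection_tile_gaussian:
  assumes "D \<in> chair_dissection" obtains m s where "D = tile m s" "s \<in> gaussian_ints"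
proof -
  have "chair = tile 0 0" by (simp add: tile_def placed_def)
  moreover have "(+) (Complex 1 1) ` chair = tile 0 (Complex 1 1)"
    by (auto simp: tile_def placed_def add.commute)
  moreover have "cbox (Complex 0 2) (Complex 1 4) \<union> cbox (Complex 0 3) (Complex 2 4) = tile 3 (Complex 0 4)"
    unfolding tile_def set_eq_iff placed_iff i_power_mod4[of "3 * 3"] mem_chair
    by (auto simp: in_cbox_complex_iff)
  moreover have "cbox (Complex 2 0) (Complex 4 1) \<union> cbox (Complex 3 0) (Complex 4 2) = tile 1 (Complex 4 0)"
    unfolding tile_def set_eq_iff placed_iff mem_chair
    by (auto simp: in_cbox_complex_iff numeral_3_eq_3)
  moreover have "{0, Complex 1 1, Complex 0 4, Complex 4 0} \<subseteq> gaussian_ints"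
    by (simp add: gaussian_ints_def)
  ultimately show thesis
    using assms that unfolding chair_dissection_def upper_eq right_eq by auto
qed

section \<open>Topology and size of tiles\<close>

lemma chair_subset_closure_interior: "chair \<subseteq> closure (interior chair)"
proof -
  have "cbox 0 b \<subseteq> closure (interior chair)" if "0 < Re b" "0 < Im b" "cbox 0 b \<subseteq> chair" for b
  proof -
    have "box 0 b \<noteq> {}" using that by (intro box_complex_nonempty) auto
    then have "cbox 0 b = closure (box 0 b)" by (simp add: closure_box)
    moreover have "box 0 b \<subseteq> interior chair"
      using that box_subset_cbox[of 0 b] by (intro interior_maximal) auto
    ultimately show ?thesis by (metis closure_mono)
  qed
  from this[of "Complex 1 2"] this[of "Complex 2 1"] show ?thesis
    by (auto simp: chair_eq)
qed

lemma continuous_on_placed: "continuous_on S (placed k t)"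
  unfolding placed_def by (intro continuous_intros)

text \<open>Lets an open set that meets a tile, even only at its boundary, be seen to meet its
  interior.\<close>

lemma tile_subset_closure_interior: "tile k t \<subseteq> closure (interior (tile k t))"
proof -
  have "placed k t ` closure (interior chair) \<subseteq> closure (interior (tile k t))"
    by (rule image_closure_subset)
      (auto simp: continuous_on_placed tile_def interior_placed intro: closure_subset[THEN subsetD])
  then show ?thesis using chair_subset_closure_interior by (auto simp: tile_def)
qed

lemma closed_tile: "closed (tile k t)"
proof -
  have "compact chair" by (auto simp: chair_eq intro: compact_Un)
  then have "compact (tile k t)"
    unfolding tile_def by (intro compact_continuous_image continuous_on_placed)
  then show ?thesis by (rule compact_imp_closed)
qed

text \<open>The centre of the unit square at the outer corner, chosen because a disc of radius 1/2
  around it fits into the tile.\<close>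

definition tile_centre :: "nat \<Rightarrow> complex \<Rightarrow> complex" where
  "tile_centre k t = placed k t (Complex (1/2) (1/2))"

lemma ball_tile_centre: "ball (tile_centre k t) (1/2) \<subseteq> tile k t"
proof
  fix z assume z: "z \<in> ball (tile_centre k t) (1/2)"
  define w where "w = \<i> ^ (3 * k) * (z - t)"
  have zw: "z = placed k t w" unfolding w_def by (rule placed_inverse[symmetric])
  have "tile_centre k t - z = \<i> ^ k * (Complex (1/2) (1/2) - w)"
    by (simp add: zw tile_centre_def placed_def algebra_simps)
  then have "cmod (Complex (1/2) (1/2) - w) < 1/2"
    using z by (simp add: dist_norm norm_mult norm_power)
  then have "w \<in> chair"
    using abs_Re_le_cmod[of "Complex (1/2) (1/2) - w"] abs_Im_le_cmod[of "Complex (1/2) (1/2) - w"]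
    by (auto simp: mem_chair)
  then show "z \<in> tile k t" by (auto simp: tile_def zw)
qed

lemma dist_tile_centre:
  assumes "z \<in> tile k t" shows "dist z (tile_centre k t) \<le> 4"
proof -
  obtain w where w: "w \<in> chair" "z = placed k t w" using assms by (auto simp: tile_def)
  have "z - tile_centre k t = \<i> ^ k * (w - Complex (1/2) (1/2))"
    by (simp add: w tile_centre_def placed_def algebra_simps)
  then have "dist z (tile_centre k t) = cmod (w - Complex (1/2) (1/2))"
    by (simp add: dist_norm norm_mult norm_power)
  \<comment> \<open>A crude bound: each coordinate differs by at most 3/2. Only its uniformity over
    all tiles matters.\<close>
  also have "\<dots> \<le> 4"
    using cmod_le[of "w - Complex (1/2) (1/2)"] w(1) by (auto simp: mem_chair abs_if split: if_splits)
  finally show ?thesis .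
qed

section \<open>Tiles and their doubles near the origin\<close>

lemma eventually_half_le_iff:
  fixes a c :: real
  shows "\<forall>\<^sub>F u in nhds 0. a + u / 2 \<le> c \<longleftrightarrow> a + u \<le> c"
proof (cases "a = c")
  case False
  \<comment> \<open>A displacement smaller than the gap between \<open>a\<close> and
    \<open>c\<close> crosses \<open>c\<close> neither in full nor halved. For \<open>a = c\<close>
    both sides only test the sign of \<open>u\<close>.\<close>
  then have "0 < \<bar>a - c\<bar>" by simp
  moreover have "a + u / 2 \<le> c \<longleftrightarrow> a + u \<le> c" if "dist u 0 < \<bar>a - c\<bar>" for u
    using that by (auto simp: abs_if split: if_splits)
  ultimately show ?thesis unfolding eventually_nhds_metric by blast
qed auto

lemma eventually_half_ge_iff:
  fixes a c :: real
  shows "\<forall>\<^sub>F u in nhds 0. c \<le> a + u / 2 \<longleftrightarrow> c \<le> a + u"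
proof (cases "a = c")
  case False
  then have "0 < \<bar>a - c\<bar>" by simp
  moreover have "c \<le> a + u / 2 \<longleftrightarrow> c \<le> a + u" if "dist u 0 < \<bar>a - c\<bar>" for u
    using that by (auto simp: abs_if split: if_splits)
  ultimately show ?thesis unfolding eventually_nhds_metric by blast
qed auto

text \<open>The chair is cut out by comparisons of one coordinate with 0, 1 or 2, and halving a
  small displacement changes none of them.\<close>

lemma eventually_chair_half_iff:
  "\<forall>\<^sub>F u in nhds 0. w + u / 2 \<in> chair \<longleftrightarrow> w + u \<in> chair"
proof -
  have Re: "filterlim Re (nhds 0) (nhds 0)" and Im: "filterlim Im (nhds 0) (nhds 0)"
    using tendsto_Re[OF filterlim_ident[of "nhds 0"]] tendsto_Im[OF filterlim_ident[of "nhds 0"]]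
    by auto
  note le = eventually_half_le_iff and ge = eventually_half_ge_iff
  note ev = eventually_compose_filterlim[OF _ Re] eventually_compose_filterlim[OF _ Im]
  show ?thesis
    using ev(1)[OF le[of "Re w" 1]] ev(1)[OF le[of "Re w" 2]] ev(1)[OF ge[of 0 "Re w"]]
      ev(2)[OF le[of "Im w" 1]] ev(2)[OF le[of "Im w" 2]] ev(2)[OF ge[of 0 "Im w"]]
    by eventually_elim (simp add: mem_chair)
qed

lemma double_tile_near_origin:
  obtains U where "open U" "0 \<in> U" "U \<inter> (\<lambda>z. 2 * z) ` tile k t \<subseteq> tile k t"
proof -
  \<comment> \<open>\<open>w\<close> is the origin in the coordinates of the tile, where
    \<open>z\<close> becomes \<open>w + \<i> ^ (3 * k) * z\<close>.\<close>
  define w where "w = - (\<i> ^ (3 * k) * t)"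
  have "((\<lambda>z. \<i> ^ (3 * k) * z) \<longlongrightarrow> \<i> ^ (3 * k) * 0) (nhds 0)"
    by (intro tendsto_intros filterlim_ident)
  then have "filterlim (\<lambda>z. \<i> ^ (3 * k) * z) (nhds 0) (nhds 0)" by simp
  from eventually_compose_filterlim[OF eventually_chair_half_iff[of w] this]
  obtain U where U: "open U" "0 \<in> U"
    "\<And>z. z \<in> U \<Longrightarrow> w + \<i> ^ (3 * k) * z / 2 \<in> chair \<longleftrightarrow> w + \<i> ^ (3 * k) * z \<in> chair"
    unfolding eventually_nhds by blast
  have "z \<in> tile k t" if "z \<in> U" "z \<in> (\<lambda>z. 2 * z) ` tile k t" for z
  proof -
    have "z / 2 \<in> tile k t" using that by auto
    then have "w + \<i> ^ (3 * k) * z / 2 \<in> chair"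
      by (simp add: tile_def placed_iff w_def algebra_simps)
    then have "w + \<i> ^ (3 * k) * z \<in> chair" using U that by blast
    then show ?thesis by (simp add: tile_def placed_iff w_def algebra_simps)
  qed
  then show thesis using U that by blast
qed

section \<open>Integrality of tile positions\<close>

lemma chair_tiling_overlap_eq:
  assumes "chair_tiling T" "\<sigma> \<in> T" "\<tau> \<in> T" "interior \<sigma> \<inter> interior \<tau> \<noteq> {}"
  shows "\<sigma> = \<tau>"
  using assms unfolding chair_tiling_def plane_tiling_def by blast

lemma placed_dissection_subset:
  assumes "D \<in> chair_dissection"
  shows "placed k (2 * t) ` D \<subseteq> (\<lambda>z. 2 * z) ` tile k t"
  using assms dissection_Union unfolding tile_def placed_double[symmetric] by blast

lemma gaussian_ints_tile_origin:
  assumes T: "chair_tiling T" and "tile k t \<in> T" and "0 \<in> tile k t"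
  shows "t \<in> gaussian_ints"
proof -
  have "0 \<in> (\<lambda>z. 2 * z) ` tile k t" using assms(3) by force
  then obtain D where D: "D \<in> chair_dissection" "0 \<in> placed k (2 * t) ` D"
    unfolding tile_def placed_double[symmetric] dissection_Union[symmetric] by blast
  define \<sigma> where "\<sigma> = placed k (2 * t) ` D"
  obtain m s where ms: "D = tile m s" "s \<in> gaussian_ints"
    using dissection_tile_gaussian D(1) by blast
  then have \<sigma>: "\<sigma> = tile (k + m) (\<i> ^ k * s + 2 * t)"
    by (simp add: \<sigma>_def tile_def placed_placed)
  have "\<sigma> \<in> chair_subst T" unfolding \<sigma>_def chair_subst_def using assms(2) D(1) by blast
  then have "\<sigma> \<in> T" using T by (simp add: chair_tiling_def)
  obtain U where U: "open U" "0 \<in> U" "U \<inter> (\<lambda>z. 2 * z) ` tile k t \<subseteq> tile k t"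
    by (rule double_tile_near_origin)
  \<comment> \<open>The origin may lie on the boundary of \<open>\<sigma>\<close>, but interior
    points of \<open>\<sigma>\<close> accumulate there, so some lie in \<open>U\<close>.\<close>
  have "0 \<in> closure (interior \<sigma>)"
    using D(2) tile_subset_closure_interior \<sigma> \<sigma>_def by blast
  then have "interior \<sigma> \<inter> U \<noteq> {}"
    using U(1,2) by (metis Int_commute disjoint_iff open_Int_closure_eq_empty)
  moreover have "interior \<sigma> \<inter> U \<subseteq> interior (tile k t)"
    using U interior_subset[of \<sigma>] placed_dissection_subset[OF D(1), of k t]
    unfolding \<sigma>_def by (intro interior_maximal) (blast, auto intro: open_Int)
  ultimately have "\<sigma> = tile k t"
    using chair_tiling_overlap_eq[OF T \<open>\<sigma> \<in> T\<close> assms(2)] by blast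
  then have "\<i> ^ k * s + 2 * t = t" using \<sigma> tile_inject by blast
  then have "t = - (\<i> ^ k * s)" by (simp add: algebra_simps eq_neg_iff_add_eq_0)
  then show ?thesis using ms gaussian_ints_i_power gaussian_ints_uminus by blast
qed

text \<open>The fixed point equation read backwards: every tile is a piece of a doubled tile. Its
  position is twice that of the parent plus a Gaussian integer, so integrality passes from parent to
  child.\<close>

lemma chair_tiling_parent:
  assumes T: "chair_tiling T" and "tile k t \<in> T"
  obtains k' t' where "tile k' t' \<in> T" "tile k t \<subseteq> (\<lambda>z. 2 * z) ` tile k' t'"
    "t' \<in> gaussian_ints \<Longrightarrow> t \<in> gaussian_ints"
proof -
  have "tile k t \<in> chair_subst T" using assms by (simp add: chair_tiling_def)
  then obtain k' t' D where p: "tile k t = placed k' (2 * t') ` D" "tile k' t' \<in> T" "D \<in> chair_dissection"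
    unfolding chair_subst_def by auto
  obtain m s where ms: "D = tile m s" "s \<in> gaussian_ints"
    using dissection_tile_gaussian p(3) by blast
  then have "tile k t = tile (k' + m) (\<i> ^ k' * s + 2 * t')"
    unfolding p(1) by (simp add: tile_def placed_placed)
  then have "t = \<i> ^ k' * s + 2 * t'" using tile_inject by blast
  then have "t' \<in> gaussian_ints \<Longrightarrow> t \<in> gaussian_ints"
    using ms gaussian_ints_add gaussian_ints_double gaussian_ints_i_power by blast
  then show thesis using that p placed_dissection_subset by metis
qed

text \<open>Repeated division by \<open>2 ^ p\<close> gives a sequence in \<open>S\<close> tending
  to \<open>0\<close>.\<close>

lemma mem_origin_of_subset_scaled:
  fixes S :: "complex set"
  assumes "closed S" "S \<noteq> {}" "p > 0" and scaled: "\<And>z. z \<in> S \<Longrightarrow> z / 2 ^ p \<in> S"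
  shows "0 \<in> S"
proof -
  obtain z where z: "z \<in> S" using assms by blast
  have mem: "z * (1 / 2 ^ p) ^ n \<in> S" for n
  proof (induction n)
    case (Suc n)
    from scaled[OF Suc] show ?case by (simp add: mult.commute)
  qed (use z in simp)
  have "norm (1 / 2 ^ p :: complex) < 1"
    using assms(3) by (simp add: norm_divide norm_power)
  then have "(\<lambda>n. z * (1 / 2 ^ p) ^ n) \<longlonglongrightarrow> z * 0"
    by (intro tendsto_intros LIMSEQ_power_zero)
  then show ?thesis using closed_sequentially[OF assms(1), of "\<lambda>n. z * (1 / 2 ^ p) ^ n"] mem by simp
qed

lemma chair_tiling_gaussian_ints:
  assumes T: "chair_tiling T" and "tile k t \<in> T"
  shows "t \<in> gaussian_ints"
proof -
  \<comment> \<open>Dependent choice builds the chain of ancestors: \<open>?P\<close> fixes its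
    start, \<open>?Q\<close> links each tile to its parent.\<close>
  let ?P = "\<lambda>(n :: nat) (x :: nat \<times> complex). tile (fst x) (snd x) \<in> T \<and> (n = 0 \<longrightarrow> x = (k, t))"
  let ?Q = "\<lambda>(n :: nat) (x :: nat \<times> complex) y. tile (fst x) (snd x) \<subseteq> (\<lambda>z. 2 * z) ` tile (fst y) (snd y)
     \<and> (snd y \<in> gaussian_ints \<longrightarrow> snd x \<in> gaussian_ints)"
  obtain f where f: "\<And>n. ?P n (f n) \<and> ?Q n (f n) (f (Suc n))"
  proof (atomize_elim, rule dependent_nat_choice)
    show "\<exists>x. ?P 0 x" using assms(2) by auto
    fix x :: "nat \<times> complex" and n assume "?P n x"
    then obtain k' t' where "tile k' t' \<in> T" "tile (fst x) (snd x) \<subseteq> (\<lambda>z. 2 * z) ` tile k' t'"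
      "t' \<in> gaussian_ints \<Longrightarrow> snd x \<in> gaussian_ints"
      using chair_tiling_parent[OF T] by metis
    then show "\<exists>y. ?P (Suc n) y \<and> ?Q n x y" by (intro exI[of _ "(k', t')"]) auto
  qed
  define \<sigma> where "\<sigma> n = tile (fst (f n)) (snd (f n))" for n
  define c where "c n = tile_centre (fst (f n)) (snd (f n))" for n
  have \<sigma>T: "\<sigma> n \<in> T" for n using f \<sigma>_def by auto
  have shrink: "z / 2 ^ m \<in> \<sigma> (n + m)" if "z \<in> \<sigma> n" for z m n
  proof (induction m)
    case (Suc m)
    have "\<sigma> (n + m) \<subseteq> (\<lambda>z. 2 * z) ` \<sigma> (Suc (n + m))"
      using f[of "n + m"] by (simp add: \<sigma>_def)
    then obtain y where "y \<in> \<sigma> (Suc (n + m))" "z / 2 ^ m = 2 * y" using Suc by blast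
    moreover from this have "z / 2 ^ Suc m = y" by (simp add: field_simps)
    ultimately show ?case by simp
  qed (use that in simp)
  have ball: "ball (c n) (1/2) \<subseteq> \<sigma> n" for n
    unfolding c_def \<sigma>_def by (rule ball_tile_centre)
  then have c0: "c n \<in> \<sigma> n" for n by force
  have "norm (c n) \<le> norm (c 0) + 4" for n
  proof -
    \<comment> \<open>The point \<open>c 0 / 2 ^ n\<close> lies in the \<open>n\<close>-th ancestor,
      hence near its centre.\<close>
    have "norm (c n - c 0 / 2 ^ n) \<le> 4"
      using dist_tile_centre[of "c 0 / 2 ^ n" "fst (f n)" "snd (f n)"] shrink[OF c0, of 0 n]
      by (simp add: \<sigma>_def c_def dist_norm norm_minus_commute)
    moreover have "norm (c 0 / 2 ^ n) \<le> norm (c 0)"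
      by (simp add: norm_divide norm_power divide_le_eq mult_left_le_one_le
          mult_le_cancel_left1)
    ultimately show ?thesis
      using norm_triangle_ineq[of "c n - c 0 / 2 ^ n" "c 0 / 2 ^ n"] by simp
  qed
  then have "bounded (range c)" unfolding bounded_iff by blast
  then obtain l r where r: "strict_mono r" "(c \<circ> r) \<longlonglongrightarrow> l"
    using bounded_imp_convergent_subsequence by blast
  then have "Cauchy (c \<circ> r)" using LIMSEQ_imp_Cauchy by blast
  then obtain N where "\<forall>m\<ge>N. \<forall>n\<ge>N. dist ((c \<circ> r) m) ((c \<circ> r) n) < 1/2"
    unfolding Cauchy_def by (meson half_gt_zero zero_less_one)
  \<comment> \<open>Below the inscribed radius 1/2, the later centre is interior to the earlier
    ancestor too.\<close>
  then have close: "dist (c (r N)) (c (r (Suc N))) < 1/2" by simp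
  define n where "n = r N"
  define p where "p = r (Suc N) - r N"
  have p: "p > 0" "r (Suc N) = n + p"
    using strict_monoD[OF r(1), of N "Suc N"] by (auto simp: n_def p_def)
  have "c (n + p) \<in> interior (\<sigma> n)" "c (n + p) \<in> interior (\<sigma> (n + p))"
    using close p(2) interior_maximal[OF ball open_ball] by (auto simp: n_def subset_iff)
  then have eq: "\<sigma> n = \<sigma> (n + p)" using chair_tiling_overlap_eq[OF T \<sigma>T \<sigma>T] by blast
  have "0 \<in> \<sigma> n"
  proof (rule mem_origin_of_subset_scaled[OF _ _ p(1)])
    show "closed (\<sigma> n)" unfolding \<sigma>_def by (rule closed_tile)
    show "\<sigma> n \<noteq> {}" using c0 by blast
    show "z / 2 ^ p \<in> \<sigma> n" if "z \<in> \<sigma> n" for z using shrink[OF that, of p] eq by simp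
  qed
  then have "snd (f n) \<in> gaussian_ints"
    using gaussian_ints_tile_origin[OF T] \<sigma>T unfolding \<sigma>_def by blast
  \<comment> \<open>Integrality descends the chain, one parent-child link at a time.\<close>
  then have "snd (f 0) \<in> gaussian_ints"
    by (induction n) (use f in auto)
  then show ?thesis using f[of 0] by simp
qed

section \<open>The two-colouring and the chromatic number\<close>

lemma tiling_edge_parity:
  assumes T: "chair_tiling T" and "e \<in> tiling_edges T"
  obtains a b where "e = {a, b}" "a \<in> tiling_vertices T" "b \<in> tiling_vertices T"
    "even_point a" "\<not> even_point b"
proof -
  obtain k t j where e: "tile k t \<in> T" "j < 8"
    "e = {placed k t (chair_corners ! j), placed k t (chair_corners ! ((j + 1) mod 8))}"
    using assms(2) unfolding tiling_edges_def by blast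
  define x where "x i = placed k t (chair_corners ! i)" for i
  have len: "length chair_corners = 8" by (simp add: chair_corners_def)
  have V: "x i \<in> tiling_vertices T" if "i < 8" for i
    using e(1) that nth_mem[of i chair_corners] unfolding tiling_vertices_def x_def len by blast
  have par: "even_point (x i) \<longleftrightarrow> (even_point t \<longleftrightarrow> even i)" if "i < 8" for i
    using that chair_tiling_gaussian_ints[OF T e(1)]
    by (simp add: x_def even_point_placed nth_chair_corners_gaussian_ints even_point_chair_corners)
  \<comment> \<open>As 8 is even, the closing edge from corner 7 to corner 0 also joins opposite
    parities.\<close>
  have j': "(j + 1) mod 8 < 8" "even ((j + 1) mod 8) \<longleftrightarrow> odd j"
    using e(2) by (simp, presburger)
  have "even_point (x j) \<longleftrightarrow> \<not> even_point (x ((j + 1) mod 8))"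
    using par[OF e(2)] par[OF j'(1)] j'(2) by blast
  moreover have "e = {x j, x ((j + 1) mod 8)}" using e(3) by (simp add: x_def)
  moreover note V[OF e(2)] V[OF j'(1)]
  ultimately show thesis using that by (metis insert_commute)
qed

text \<open>Supplies the edge for the lower bound: a cover of the plane contains a tile.\<close>

lemma tiling_edges_nonempty:
  assumes "plane_tiling T" shows "tiling_edges T \<noteq> {}"
proof -
  obtain k t where "tile k t \<in> T"
    using assms unfolding plane_tiling_def by (metis UNIV_I Union_iff)
  then have "{placed k t (chair_corners ! 0), placed k t (chair_corners ! ((0 + 1) mod 8))} \<in> tiling_edges T"
    unfolding tiling_edges_def by (intro CollectI exI[of _ k] exI[of _ t] exI[of _ 0]) auto
  then show ?thesis by blast
qed

theorem mainTheorem2: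
  fixes T :: "complex set set"
  assumes "chair_tiling T"
  shows "bipartite (tiling_vertices T) (tiling_edges T) \<and>
         colourable (tiling_vertices T) (tiling_edges T) 2 \<and>
         chromatic_number (tiling_vertices T) (tiling_edges T) = 2"
proof -
  let ?V = "tiling_vertices T" and ?E = "tiling_edges T"
  have "bipartite ?V ?E"
    unfolding bipartite_def
    by (rule exI[of _ "{v \<in> ?V. even_point v}"], rule exI[of _ "{v \<in> ?V. \<not> even_point v}"])
      (auto elim!: tiling_edge_parity[OF assms])
  moreover have col: "colourable ?V ?E 2"
    unfolding colourable_def
    by (rule exI[of _ "\<lambda>v. if even_point v then 0 else 1"])
      (auto elim!: tiling_edge_parity[OF assms] simp: doubleton_eq_iff)
  moreover have "chromatic_number ?V ?E = 2"
  proof -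
    \<comment> \<open>The ends of a single edge already use two distinct colours below
      \<open>n\<close>.\<close>
    have "enat 2 \<le> enat n" if n: "colourable ?V ?E n" for n
    proof -
      obtain e where "e \<in> ?E"
        using tiling_edges_nonempty assms unfolding chair_tiling_def by blast
      then obtain a b where "{a, b} \<in> ?E" "a \<in> ?V" "b \<in> ?V"
        using tiling_edge_parity[OF assms] by metis
      moreover obtain c :: "complex \<Rightarrow> nat" where "\<forall>v\<in>?V. c v < n" "\<forall>u v. {u, v} \<in> ?E \<longrightarrow> c u \<noteq> c v"
        using n unfolding colourable_def by blast
      ultimately have "c a < n" "c b < n" "c a \<noteq> c b" by blast+
      then show ?thesis by simp
    qed
    then have "chromatic_number ?V ?E = enat 2"
      unfolding chromatic_number_def using col
      by (intro antisym INF_lower INF_greatest) auto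
    then show ?thesis by (simp add: numeral_eq_enat)
  qed
  ultimately show ?thesis by blast
qed

end
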